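(* Let $R$ be an associative ring with identity and let $n$ be a positive integer. If $R$ is 2-primal, then $R[x]/\langle x^{n}\rangle$ is strongly nil-IFP.
   Context: Rings are not necessarily commutative; the indeterminate $x$ commutes with coefficients, and $\langle x^n\rangle$ is the ideal of $R[x]$ generated by $x^n$. For a ring $A$, $N(A)$ denotes the set of nilpotent elements and $N_{*}(A)$ the prime radical (lower nil radical). A ring $A$ is 2-primal if $N_{*}(A)=N(A)$. For a polynomial $f$ over $A$, $C_{f}$ denotes the set of all coefficients of $f$. A ring $A$ is strongly nil-IFP if whenever $f(t),g(t)\in A[t]$ satisfy $f(t)g(t)=0$, then $arb\in N(A)$ for all $a\in C_{f}$, $b\in C_{g}$ and all $r\in A$. *)

theory Defs
  imports "HOL-Algebra.Ideal_Product" "HOL-Algebra.QuotRing" "HOL-Algebra.UnivPoly"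
begin

definition nilpotent_elements :: "('a, 'b) ring_scheme \<Rightarrow> 'a set"
  where "nilpotent_elements A =
    {a \<in> carrier A. \<exists>k::nat. k > 0 \<and> a [^]\<^bsub>A\<^esub> k = \<zero>\<^bsub>A\<^esub>}"

text \<open>The locale \<^locale>\<open>primeideal\<close> demands a commutative ring and primeness on elements.
  Over a noncommutative ring, primeness refers to products of two-sided ideals.\<close>

definition nc_prime_ideal :: "'a set \<Rightarrow> ('a, 'b) ring_scheme \<Rightarrow> bool"
  where "nc_prime_ideal P A \<longleftrightarrow>
    ideal P A \<and> P \<noteq> carrier A \<and>
    (\<forall>I J. ideal I A \<longrightarrow> ideal J A \<longrightarrow> I \<cdot>\<^bsub>A\<^esub> J \<subseteq> P \<longrightarrow> I \<subseteq> P \<or> J \<subseteq> P)"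

text \<open>The zero ring has no prime ideals; its prime radical is then the whole carrier.\<close>

definition prime_radical :: "('a, 'b) ring_scheme \<Rightarrow> 'a set"
  where "prime_radical A = {a \<in> carrier A. \<forall>P. nc_prime_ideal P A \<longrightarrow> a \<in> P}"

definition two_primal :: "('a, 'b) ring_scheme \<Rightarrow> bool"
  where "two_primal A \<longleftrightarrow> prime_radical A = nilpotent_elements A"

text \<open>Besides the coefficients up to the degree, this set always contains zero.\<close>

definition coeff_set :: "('a, 'b) ring_scheme \<Rightarrow> (nat \<Rightarrow> 'a) \<Rightarrow> 'a set"
  where "coeff_set A f = range (coeff (UP A) f)"

definition strongly_nil_IFP :: "('a, 'b) ring_scheme \<Rightarrow> bool"
  where "strongly_nil_IFP A \<longleftrightarrow>
    (\<forall>f \<in> carrier (UP A). \<forall>g \<in> carrier (UP A).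
       f \<otimes>\<^bsub>UP A\<^esub> g = \<zero>\<^bsub>UP A\<^esub> \<longrightarrow>
       (\<forall>a \<in> coeff_set A f. \<forall>b \<in> coeff_set A g. \<forall>r \<in> carrier A.
          a \<otimes>\<^bsub>A\<^esub> r \<otimes>\<^bsub>A\<^esub> b \<in> nilpotent_elements A))"

definition poly_var :: "('a, 'b) ring_scheme \<Rightarrow> nat \<Rightarrow> 'a"
  where "poly_var R = monom (UP R) \<one>\<^bsub>R\<^esub> 1"

definition truncated_poly_ring :: "('a, 'b) ring_scheme \<Rightarrow> nat \<Rightarrow> (nat \<Rightarrow> 'a) set ring"
  where "truncated_poly_ring R n =
    UP R Quot (Idl\<^bsub>UP R\<^esub> {poly_var R [^]\<^bsub>UP R\<^esub> n})"

end

theory Submission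
  imports Defs
begin

text \<open>If all nilpotent elements form an ideal, it is completely semiprime; modulo such an ideal
  \<open>ab = 0\<close> implies \<open>ba = 0\<close> and \<open>arb = 0\<close>, and a vanishing product of polynomials has
  vanishing products of coefficients. So a ring whose nilpotent elements form an ideal is
  strongly nil-IFP. In \<open>R[x]/\<langle>x\<^sup>n\<rangle>\<close> an element is nilpotent exactly when its constant
  coefficient is nilpotent in \<open>R\<close>, so if \<open>N(R)\<close> is an ideal then its preimage in \<open>R[x]\<close> is
  an ideal with image \<open>N(R[x]/\<langle>x\<^sup>n\<rangle>)\<close>.\<close>

text \<open>The prime radical is an intersection of ideals. Inserting \<open>carrier R\<close> keeps
  the family nonempty, as \<open>i_Intersect\<close> requires, even if there are no prime
  ideals.\<close>

lemma (in ring) two_primal_nilpotents_ideal: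
  assumes "two_primal R"
  shows "ideal (nilpotent_elements R) R"
proof -
  have "nilpotent_elements R = \<Inter> (insert (carrier R) {P. nc_prime_ideal P R})"
    using assms by (auto simp: two_primal_def prime_radical_def)
  moreover have "ideal (\<Inter> (insert (carrier R) {P. nc_prime_ideal P R})) R"
    by (rule i_Intersect) (auto simp: nc_prime_ideal_def oneideal)
  ultimately show ?thesis by simp
qed

section \<open>Completely semiprime ideals, that is, ideals with reduced quotient\<close>

locale completely_semiprime_ideal = ideal N R for N and R (structure) +
  assumes square: "a \<in> carrier R \<Longrightarrow> a \<otimes> a \<in> N \<Longrightarrow> a \<in> N"
begin

text \<open>The square of ba is b(ab)a, which contains the factor ab.\<close>

lemma mult_swap:
  assumes "a \<in> carrier R" "b \<in> carrier R" "a \<otimes> b \<in> N"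
  shows "b \<otimes> a \<in> N"
proof (rule square)
  have "b \<otimes> (a \<otimes> b) \<otimes> a \<in> N"
    using assms by (simp add: I_l_closed I_r_closed)
  then show "b \<otimes> a \<otimes> (b \<otimes> a) \<in> N"
    using assms by (simp add: m_assoc)
qed (use assms in simp)

text \<open>The square of arb is ar(ba)rb, and ba lies in \<open>N\<close> by
  \<open>mult_swap\<close>.\<close>

lemma mult_insert:
  assumes "a \<in> carrier R" "b \<in> carrier R" "r \<in> carrier R" "a \<otimes> b \<in> N"
  shows "a \<otimes> r \<otimes> b \<in> N"
proof (rule square)
  have "a \<otimes> r \<otimes> (b \<otimes> a) \<otimes> (r \<otimes> b) \<in> N"
    using assms mult_swap[of a b] by (simp add: I_l_closed I_r_closed)
  then show "a \<otimes> r \<otimes> b \<otimes> (a \<otimes> r \<otimes> b) \<in> N"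
    using assms by (simp add: m_assoc)
qed (use assms in simp)

lemma finsum_mem:
  assumes "finite A" "\<And>i. i \<in> A \<Longrightarrow> f i \<in> N"
  shows "finsum R f A \<in> N"
  using assms
proof (induction A rule: finite_induct)
  case (insert x A)
  then show ?case
    by (subst finsum_insert) (auto simp: Icarr)
qed auto

lemma add_cancel:
  assumes "a \<in> carrier R" "b \<in> N" "a \<oplus> b \<in> N"
  shows "a \<in> N"
proof -
  have "a = (a \<oplus> b) \<ominus> b"
    using assms Icarr[of b] by (simp add: a_minus_def a_assoc r_neg)
  then show ?thesis
    using assms(2,3) additive_subgroup.a_inv_closed[OF additive_subgroup_axioms, of b]
      additive_subgroup.a_closed[OF additive_subgroup_axioms, of "a \<oplus> b" "\<ominus> b"]
    by (simp add: a_minus_def)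
qed

text \<open>This is the Armendariz property of reduced rings, read modulo \<open>N\<close>. The
  proof is a double induction: on the total index k, and for fixed k on the index i of the left
  factor.\<close>

lemma armendariz:
  fixes f g :: "nat \<Rightarrow> 'a"
  assumes f: "\<And>i. f i \<in> carrier R" and g: "\<And>i. g i \<in> carrier R"
    and conv: "\<And>k. (\<Oplus>i\<in>{..k}. f i \<otimes> g (k - i)) \<in> N"
  shows "f i \<otimes> g j \<in> N"
proof -
  have "\<forall>i\<le>k. f i \<otimes> g (k - i) \<in> N" for k
  proof (induction k rule: less_induct)
    case (less k)
    have "i \<le> k \<Longrightarrow> f i \<otimes> g (k - i) \<in> N" for i
    proof (induction i rule: less_induct)
      case (less i)
      \<comment> \<open>Multiplying the k-th convolution by \<open>f i\<close> on the right puts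
        every term except the i-th into \<open>N\<close>: those with l < i by the inner induction,
        those with l > i by the outer one.\<close>
      let ?h = "\<lambda>l. f l \<otimes> g (k - l) \<otimes> f i"
      have rest: "?h l \<in> N" if l: "l \<in> {..k} - {i}" for l
      proof (cases "l < i")
        case True
        then show ?thesis
          using less f by (simp add: I_r_closed)
      next
        case False
        with l have "i < l" "l \<le> k" by auto
        \<comment> \<open>The factors \<open>f i\<close> and \<open>g (k - l)\<close> have total
          index below k, so their product is in \<open>N\<close>; \<open>mult_swap\<close> reverses
          it into the order occurring in \<open>?h l\<close>.\<close>
        then have "i + (k - l) < k" by simp
        then have "f i \<otimes> g (i + (k - l) - i) \<in> N"
          using \<open>\<And>y. y < k \<Longrightarrow> \<forall>i\<le>y. f i \<otimes> g (y - i) \<in> N\<close> le_add1 by blast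
        then have "g (k - l) \<otimes> f i \<in> N"
          using f g mult_swap[of "f i" "g (k - l)"] by simp
        then show ?thesis
          using f g by (simp add: m_assoc I_l_closed)
      qed
      have "(\<Oplus>l\<in>{..k}. f l \<otimes> g (k - l)) \<otimes> f i \<in> N"
        using conv f by (simp add: I_r_closed)
      then have total: "finsum R ?h {..k} \<in> N"
        using f g by (simp add: finsum_ldistr Pi_def)
      have "{..k} = insert i ({..k} - {i})"
        using less.prems by auto
      then have "finsum R ?h {..k} = finsum R ?h (insert i ({..k} - {i}))"
        by simp
      then have split: "finsum R ?h {..k} = ?h i \<oplus> finsum R ?h ({..k} - {i})"
        using f g by (simp add: Pi_def del: insert_Diff_single)
      have "finsum R ?h ({..k} - {i}) \<in> N"
        by (rule finsum_mem) (simp, rule rest)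
      then have "?h i \<in> N"
        using total f g by (intro add_cancel[of "?h i"]) (simp_all add: split)
      \<comment> \<open>One more factor turns the isolated term into the square of
        \<open>f i \<otimes> g (k - i)\<close>.\<close>
      then have "?h i \<otimes> g (k - i) \<in> N"
        using g by (simp add: I_r_closed)
      then have "f i \<otimes> g (k - i) \<otimes> (f i \<otimes> g (k - i)) \<in> N"
        using f g by (simp add: m_assoc)
      then show ?case
        using f g by (intro square[of "f i \<otimes> g (k - i)"]) auto
    qed
    then show ?case by blast
  qed
  from this[of "i + j"] show ?thesis by (metis add_diff_cancel_left' le_add1)
qed

end

section \<open>Rings whose nilpotent elements form an ideal\<close>

lemma (in ring) UP_ring_axioms: "UP_ring R"
  by unfold_locales

lemma (in ring) nilpotents_ideal_imp_strongly_nil_IFP: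
  assumes "ideal (nilpotent_elements R) R"
  shows "strongly_nil_IFP R"
proof -
  interpret N: ideal "nilpotent_elements R" R by fact
  interpret N: completely_semiprime_ideal "nilpotent_elements R" R
  proof
    fix a assume a: "a \<in> carrier R" "a \<otimes> a \<in> nilpotent_elements R"
    then obtain k :: nat where k: "k > 0" "(a \<otimes> a) [^] k = \<zero>"
      unfolding nilpotent_elements_def by blast
    have "a [^] (2 * k) = (a [^] (2::nat)) [^] k"
      using a by (simp add: nat_pow_pow)
    also have "a [^] (2::nat) = a \<otimes> a"
      using a by (simp add: numeral_2_eq_2)
    finally have "a [^] (2 * k) = \<zero>"
      using k by simp
    moreover have "2 * k > 0"
      using k by simp
    ultimately show "a \<in> nilpotent_elements R"
      using a unfolding nilpotent_elements_def by blast
  qed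
  interpret UP_ring R "UP R" by (rule UP_ring_axioms) simp
  show ?thesis
    unfolding strongly_nil_IFP_def coeff_set_def
  proof (intro ballI impI, elim imageE)
    fix f g r a b i j
    assume f: "f \<in> carrier (UP R)" and g: "g \<in> carrier (UP R)"
      and fg: "f \<otimes>\<^bsub>UP R\<^esub> g = \<zero>\<^bsub>UP R\<^esub>" and r: "r \<in> carrier R"
      and ab: "a = coeff (UP R) f i" "b = coeff (UP R) g j"
    \<comment> \<open>These sums are the coefficients of the product fg.\<close>
    have "(\<Oplus>i\<in>{..k}. coeff (UP R) f i \<otimes> coeff (UP R) g (k - i)) = \<zero>" for k
      using f g fg coeff_mult[of f g k] by simp
    then have "coeff (UP R) f i \<otimes> coeff (UP R) g j \<in> nilpotent_elements R"
      using f g by (intro N.armendariz) auto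
    then show "a \<otimes> r \<otimes> b \<in> nilpotent_elements R"
      using f g r ab by (simp add: N.mult_insert)
  qed
qed

section \<open>Constant coefficients and divisibility by powers of x\<close>

context UP_ring
begin

text \<open>Evaluation at 0 is multiplicative without commutativity. It serves to compute constant
  terms of powers and to pull ideals of \<open>R\<close> back to polynomials.\<close>

lemma coeff_0_ring_hom_ring: "ring_hom_ring P R (\<lambda>p. coeff P p 0)"
  by (rule ring_hom_ringI2) (auto intro!: ring_hom_memI simp: P.ring_axioms R.ring_axioms)

lemma var_pow: "monom P \<one> 1 [^]\<^bsub>P\<^esub> (n::nat) = monom P \<one> n"
  by (induction n) (simp_all only: P.nat_pow_0 P.nat_pow_Suc monom_one monom_one_Suc)

text \<open>The quotient is obtained by shifting the coefficients of \<open>q\<close> down by n. A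
  one-sided multiple suffices for membership in the two-sided ideal generated by x^n.\<close>

lemma factor_monom:
  assumes q: "q \<in> carrier P" and low: "\<And>i. i < n \<Longrightarrow> coeff P q i = \<zero>"
  shows "\<exists>q'\<in>carrier P. q = q' \<otimes>\<^bsub>P\<^esub> monom P \<one> n"
proof -
  define q' where "q' = (\<lambda>i. coeff P q (i + n))"
  obtain m where "bound \<zero> m (coeff P q)"
    using q by (auto simp: UP_def P_def)
  then have "bound \<zero> m q'"
    by (auto simp: bound_def q'_def)
  then have up: "q' \<in> up R"
    using q by (auto simp: q'_def intro!: mem_upI)
  then have q': "q' \<in> carrier P" and coeff_q': "coeff P q' = q'"
    by (auto simp: UP_def P_def)
  have "coeff P q k = coeff P (q' \<otimes>\<^bsub>P\<^esub> monom P \<one> n) k" for k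
  proof (cases "k < n")
    case True
    then show ?thesis
      using q q' low
      by (auto intro!: R.add.finprod_one_eqI[symmetric])
  next
    case False
    \<comment> \<open>Since n is at most k, the monomial has coefficient one at k - i exactly for i
      = k - n.\<close>
    have "coeff P (q' \<otimes>\<^bsub>P\<^esub> monom P \<one> n) k = (\<Oplus>i\<in>{..k}. if k - n = i then q' i else \<zero>)"
      using q' False up by (auto intro!: R.finsum_cong' simp: coeff_q' mem_upD)
    also have "\<dots> = q' (k - n)"
      using up by (simp add: R.finsum_singleton mem_upD Pi_def)
    finally show ?thesis
      using False by (simp add: q'_def)
  qed
  then have "q = q' \<otimes>\<^bsub>P\<^esub> monom P \<one> n"
    using q q' by (intro up_eqI) auto
  with q' show ?thesis by blast
qed

text \<open>A polynomial without constant term is divisible by x, so its n-th power is divisible by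
  x^n.\<close>

lemma coeff_pow_eq_zero:
  assumes p: "p \<in> carrier P" "coeff P p 0 = \<zero>" and "i < n"
  shows "coeff P (p [^]\<^bsub>P\<^esub> (n::nat)) i = \<zero>"
  using \<open>i < n\<close>
proof (induction n arbitrary: i)
  case (Suc n)
  have "coeff P (p [^]\<^bsub>P\<^esub> n) l \<otimes> coeff P p (i - l) = \<zero>" if "l \<le> i" for l
  proof (cases "l < n")
    case True
    then show ?thesis using Suc.IH p by simp
  next
    case False
    \<comment> \<open>Here l and i both equal n, so the other factor is the constant term of
      \<open>p\<close>.\<close>
    then have "i - l = 0" using Suc.prems that by simp
    then show ?thesis using p by simp
  qed
  then show ?case
    using p by (auto intro!: R.add.finprod_one_eqI)
qed simp

end

section \<open>Nilpotent elements of the truncated polynomial ring\<close>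

theorem theorem3p1:
  fixes R :: "('a, 'b) ring_scheme" and n :: nat
  assumes "ring R" and "n > 0" and "two_primal R"
  shows "strongly_nil_IFP (truncated_poly_ring R n)"
proof -
  interpret R: ring R by fact
  interpret UP_ring R "UP R" by (rule R.UP_ring_axioms) simp
  interpret c: ring_hom_ring "UP R" R "\<lambda>p. coeff (UP R) p 0"
    by (rule coeff_0_ring_hom_ring)
  define I where "I = Idl\<^bsub>UP R\<^esub> {monom (UP R) \<one>\<^bsub>R\<^esub> n}"
  define K where "K = {p \<in> carrier (UP R). coeff (UP R) p 0 \<in> nilpotent_elements R}"
  let ?S = "UP R Quot I"
  have S: "truncated_poly_ring R n = ?S"
    by (simp only: truncated_poly_ring_def poly_var_def var_pow I_def)
  have nil: "ideal (nilpotent_elements R) R"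
    using \<open>two_primal R\<close> by (rule R.two_primal_nilpotents_ideal)
  have idI: "ideal I (UP R)"
    unfolding I_def by (rule P.genideal_ideal) simp
  interpret I: ideal I "UP R" by (rule idI)
  interpret \<pi>: ring_hom_ring "UP R" ?S "(+>\<^bsub>UP R\<^esub>) I" by (rule I.rcos_ring_hom_ring)
  have idK: "ideal K (UP R)"
    using c.ideal_vimage[OF nil] by (simp add: K_def)
  \<comment> \<open>As n is positive, x^n has constant term zero.\<close>
  have "monom (UP R) \<one>\<^bsub>R\<^esub> n \<in> K"
    using \<open>n > 0\<close> additive_subgroup.zero_closed[OF ideal.axioms(1)[OF nil]]
    by (simp add: K_def)
  then have IK: "I \<subseteq> K"
    unfolding I_def by (intro P.genideal_minimal idK) simp
  have zero_iff: "I +>\<^bsub>UP R\<^esub> p = \<zero>\<^bsub>?S\<^esub> \<longleftrightarrow> p \<in> I" if "p \<in> carrier (UP R)" for p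
    unfolding FactRing_def
    using P.a_rcos_zero[OF idI, of p] I.rcos_const_imp_mem[OF that] by auto
  have "nilpotent_elements ?S = (+>\<^bsub>UP R\<^esub>) I ` K"
  proof (intro equalityI subsetI)
    fix X assume "X \<in> nilpotent_elements ?S"
    then obtain k :: nat where X: "X \<in> carrier ?S" and k: "k > 0" "X [^]\<^bsub>?S\<^esub> k = \<zero>\<^bsub>?S\<^esub>"
      unfolding nilpotent_elements_def by blast
    obtain p where p: "p \<in> carrier (UP R)" "X = I +>\<^bsub>UP R\<^esub> p"
      using X unfolding FactRing_def A_RCOSETS_def' partial_object.simps by blast
    have "I +>\<^bsub>UP R\<^esub> (p [^]\<^bsub>UP R\<^esub> k) = \<zero>\<^bsub>?S\<^esub>"
      using k p by (simp only: \<pi>.hom_nat_pow)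
    \<comment> \<open>The power lies in \<open>I\<close>, hence in \<open>K\<close>: a power of the
      constant term of \<open>p\<close> is nilpotent, and so is the constant term itself.\<close>
    then have "p [^]\<^bsub>UP R\<^esub> k \<in> K"
      using p IK zero_iff[of "p [^]\<^bsub>UP R\<^esub> k"] P.nat_pow_closed by blast
    then have "coeff (UP R) p 0 [^]\<^bsub>R\<^esub> k \<in> nilpotent_elements R"
      unfolding K_def using p by (simp add: c.hom_nat_pow)
    then obtain l :: nat
      where "l > 0" "(coeff (UP R) p 0 [^]\<^bsub>R\<^esub> k) [^]\<^bsub>R\<^esub> l = \<zero>\<^bsub>R\<^esub>"
      unfolding nilpotent_elements_def by blast
    then have "coeff (UP R) p 0 [^]\<^bsub>R\<^esub> (k * l) = \<zero>\<^bsub>R\<^esub>"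
      using p by (simp add: R.nat_pow_pow)
    moreover have "k * l > 0"
      using k \<open>l > 0\<close> by simp
    ultimately have "p \<in> K"
      using p unfolding K_def nilpotent_elements_def by (blast intro: coeff_closed)
    with p show "X \<in> (+>\<^bsub>UP R\<^esub>) I ` K" by blast
  next
    fix X assume "X \<in> (+>\<^bsub>UP R\<^esub>) I ` K"
    then obtain p k where p: "p \<in> carrier (UP R)" "X = I +>\<^bsub>UP R\<^esub> p"
      and k: "k > 0" "coeff (UP R) p 0 [^]\<^bsub>R\<^esub> (k::nat) = \<zero>\<^bsub>R\<^esub>"
      unfolding K_def nilpotent_elements_def by blast
    have "coeff (UP R) (p [^]\<^bsub>UP R\<^esub> k) 0 = \<zero>\<^bsub>R\<^esub>"
      using p k by (simp add: c.hom_nat_pow)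
    \<comment> \<open>The exponent k removes the constant term; the further exponent n then makes
      the power a multiple of x^n, so k * n annihilates \<open>X\<close> in the quotient.\<close>
    then have "coeff (UP R) ((p [^]\<^bsub>UP R\<^esub> k) [^]\<^bsub>UP R\<^esub> n) i = \<zero>\<^bsub>R\<^esub>" if "i < n" for i
      using p that coeff_pow_eq_zero[of "p [^]\<^bsub>UP R\<^esub> k"] P.nat_pow_closed by blast
    then have "coeff (UP R) (p [^]\<^bsub>UP R\<^esub> (k * n)) i = \<zero>\<^bsub>R\<^esub>" if "i < n" for i
      using p that by (simp add: P.nat_pow_pow)
    then obtain q where "q \<in> carrier (UP R)"
      and "p [^]\<^bsub>UP R\<^esub> (k * n) = q \<otimes>\<^bsub>UP R\<^esub> monom (UP R) \<one>\<^bsub>R\<^esub> n"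
      using factor_monom[of "p [^]\<^bsub>UP R\<^esub> (k * n)" n] p by auto
    then have "p [^]\<^bsub>UP R\<^esub> (k * n) \<in> I"
      using P.genideal_self'[of "monom (UP R) \<one>\<^bsub>R\<^esub> n"] by (simp add: I.I_l_closed flip: I_def)
    then have "X [^]\<^bsub>?S\<^esub> (k * n) = \<zero>\<^bsub>?S\<^esub>"
      using p zero_iff[of "p [^]\<^bsub>UP R\<^esub> (k * n)"] by (simp flip: \<pi>.hom_nat_pow)
    moreover have "X \<in> carrier ?S" "k * n > 0"
      using p k \<open>n > 0\<close> by (simp_all add: \<pi>.hom_closed)
    ultimately show "X \<in> nilpotent_elements ?S"
      unfolding nilpotent_elements_def by blast
  qed
  \<comment> \<open>The image of the ideal \<open>K\<close> under the quotient map is an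
    ideal.\<close>
  then have "ideal (nilpotent_elements ?S) ?S"
    using P.ring_ideal_imp_quot_ideal[OF idI idK] by simp
  then show ?thesis
    unfolding S by (rule ring.nilpotents_ideal_imp_strongly_nil_IFP[OF I.quotient_is_ring])
qed

end
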